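(* Let $\Phi_P$ be the projection to $SE(3)$ defined in the context, let $f$ be a degree-$1$ $\mathbb{R}_+$-equivariant tensor field on a finite 6-D point cloud with components of degrees $(1,1)$, $(1,0)$, $(0,1)$, and assume that the singular values $\sigma_1\ge\sigma_2\ge\sigma_3\ge0$ of $\hat r(f)$ satisfy $\sigma_2>\sigma_3$. Let $(r,t)=\Phi_P(f)$. Then $$\Phi_P(c(f))=(r,ct)\qquad\forall c\in\mathbb{R}_+ .$$
   Context: **Field.** $f$ is a finite indexed family of points $z_u=\tilde x_u\oplus\tilde y_u\in\mathbb{R}^6$ ($\tilde x_u,\tilde y_u\in\mathbb{R}^3$, $u=1,\dots,L$), with features $f_u^{1,1}\in\mathbb{R}^9$, $f_u^{1,0}\in\mathbb{R}^3$, $f_u^{0,1}\in\mathbb{R}^3$ attached to $z_u$. **Scaling.** $\mathbb{R}_+$ is the multiplicative group of positive reals. A field is called degree-$p$ $\mathbb{R}_+$-equivariant if $c\in\mathbb{R}_+$ acts on it by $(c(f))(z)=c^pf(c^{-1}z)$. Thus for a degree-$1$ field, $c(f)$ is the field supported on the points $cz_u$ with features $cf_u$. **Projection $\Phi_P$.** Let $\boldsymbol m(\tilde X)$ and $\boldsymbol m(\tilde Y)$ be the means of the first and of the last three coordinates of the points $z_u$ of the field. Let $\mathrm{Pool}_u$ denote the average over $u$, and $\tilde r=\mathrm{Pool}_u(f_u^{1,1})$, $t_X=\mathrm{Pool}_u(f_u^{1,0})$, $t_Y=\mathrm{Pool}_u(f_u^{0,1})$. Let $\hat r=\mathrm{unvec}(\tilde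 r)\in\mathbb{R}^{3\times3}$ ($\mathrm{unvec}$ is the inverse of stacking columns). Then $\Phi_P(f)=(r,t)\in SE(3)$ with $$r=\mathrm{SVD}(\hat r),\qquad t=(\boldsymbol m(\tilde Y)+t_Y)-r(\boldsymbol m(\tilde X)+t_X).$$ **SVD projection.** If $A=\hat U\hat\Sigma\hat V^T$ is a singular value decomposition with $\hat U,\hat V\in O(3)$, $\hat\Sigma=\mathrm{diag}(\sigma_1,\sigma_2,\sigma_3)$, $\sigma_1\ge\sigma_2\ge\sigma_3\ge0$, then $\mathrm{SVD}(A)=\hat U\,\mathrm{diag}(1,1,\mathrm{sign}\det(\hat U\hat V^T))\,\hat V^T\in SO(3)$; this does not depend on the chosen decomposition when $\sigma_2>\sigma_3$. *)

theory Defs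
  imports "HOL-Analysis.Analysis"
begin

section \<open>Tensor fields on a finite 6-D point cloud\<close>

text \<open>
  A field is a nonempty finite family of points with features. The index set
  $\{1,\dots,L\}$ is represented by an arbitrary finite type; points need not be distinct.
\<close>

record 'u tensor_field =
  pts :: "'u \<Rightarrow> real^6"
  feat11 :: "'u \<Rightarrow> real^9"
  feat10 :: "'u \<Rightarrow> real^3"
  feat01 :: "'u \<Rightarrow> real^3"

definition x_part :: "real^6 \<Rightarrow> real^3" where
  "x_part z = vector [z$1, z$2, z$3]"

definition y_part :: "real^6 \<Rightarrow> real^3" where
  "y_part z = vector [z$4, z$5, z$6]"

definition scale_act :: "nat \<Rightarrow> real \<Rightarrow> 'u tensor_field \<Rightarrow> 'u tensor_field" where
  "scale_act p c f =
    \<lparr>pts = (\<lambda>u. c *\<^sub>R pts f u),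
     feat11 = (\<lambda>u. c ^ p *\<^sub>R feat11 f u),
     feat10 = (\<lambda>u. c ^ p *\<^sub>R feat10 f u),
     feat01 = (\<lambda>u. c ^ p *\<^sub>R feat01 f u)\<rparr>"

text \<open>
  \<open>scale_act p c\<close> is the degree-\<open>p\<close> action $(c(f))(z) = c^p f(c^{-1}z)$ in terms of points
  and features. To see this, regard a component of a field as a function on $\mathbb{R}^6$ that
  is zero off the point cloud.
\<close>

definition field_at :: "('u::finite \<Rightarrow> real^6) \<Rightarrow> ('u \<Rightarrow> real^'n) \<Rightarrow> real^6 \<Rightarrow> real^'n" where
  "field_at P g z = (\<Sum>u | P u = z. g u)"

lemma field_at_scale:
  assumes "c > 0"
  shows "field_at (\<lambda>u. c *\<^sub>R P u) (\<lambda>u. c ^ p *\<^sub>R g u) z =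
         c ^ p *\<^sub>R field_at P g (inverse c *\<^sub>R z)"
proof -
  have "{u. c *\<^sub>R P u = z} = {u. P u = inverse c *\<^sub>R z}"
    using assms by auto
  then show ?thesis
    by (simp add: field_at_def scaleR_sum_right)
qed

corollary scale_act_field_at:
  fixes f :: "'u::finite tensor_field" and p :: nat
  assumes "c > 0"
  defines "cf \<equiv> scale_act p c f"
  shows "field_at (pts cf) (feat11 cf) z = c ^ p *\<^sub>R field_at (pts f) (feat11 f) (inverse c *\<^sub>R z)"
    and "field_at (pts cf) (feat10 cf) z = c ^ p *\<^sub>R field_at (pts f) (feat10 f) (inverse c *\<^sub>R z)"
    and "field_at (pts cf) (feat01 cf) z = c ^ p *\<^sub>R field_at (pts f) (feat01 f) (inverse c *\<^sub>R z)"
  using field_at_scale[OF assms(1)] by (simp_all add: cf_def scale_act_def)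

section \<open>SVD projection to the rotation group\<close>

definition diag3 :: "real^3 \<Rightarrow> real^3^3" where
  "diag3 s = (\<chi> i j. if i = j then s$i else 0)"

definition is_svd :: "real^3^3 \<Rightarrow> real^3^3 \<Rightarrow> real^3 \<Rightarrow> real^3^3 \<Rightarrow> bool" where
  "is_svd A U s V \<longleftrightarrow>
     orthogonal_matrix U \<and> orthogonal_matrix V \<and>
     s$1 \<ge> s$2 \<and> s$2 \<ge> s$3 \<and> s$3 \<ge> 0 \<and>
     A = U ** diag3 s ** transpose V"

definition singular_values :: "real^3^3 \<Rightarrow> real^3 \<Rightarrow> bool" where
  "singular_values A s \<longleftrightarrow> (\<exists>U V. is_svd A U s V)"

definition svd_rot :: "real^3^3 \<Rightarrow> real^3^3 \<Rightarrow> real^3^3" where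
  "svd_rot U V = U ** diag3 (vector [1, 1, sgn (det (U ** transpose V))]) ** transpose V"

text \<open>
  The choice is over whole decompositions, so nothing about independence of the decomposition
  is built into the definition.
\<close>

definition SVD :: "real^3^3 \<Rightarrow> real^3^3" where
  "SVD A = (case (SOME (U, s, V). is_svd A U s V) of (U, s, V) \<Rightarrow> svd_rot U V)"

lemma rotation_matrix_svd_rot:
  assumes "orthogonal_matrix U" "orthogonal_matrix V"
  shows "rotation_matrix (svd_rot U V)"
proof -
  let ?d = "sgn (det (U ** transpose V))"
  have dU: "det U = 1 \<or> det U = - 1" and dV: "det V = 1 \<or> det V = - 1"
    using assms det_orthogonal_matrix by blast+
  have d: "?d = det U * det V" "?d * ?d = 1"
    using dU dV by (auto simp: det_mul)
  have D: "det (diag3 (vector [1, 1, ?d])) = ?d"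
    by (simp add: det_3 diag3_def)
  have "orthogonal_matrix (diag3 (vector [1, 1, ?d]))"
    using d(2) by (simp add: orthogonal_matrix diag3_def matrix_matrix_mult_def transpose_def
        mat_def vec_eq_iff sum_3 forall_3)
  then have "orthogonal_matrix (svd_rot U V)"
    using assms by (simp add: svd_rot_def orthogonal_matrix_mul)
  moreover have "det (svd_rot U V) = 1"
    using dU dV d(1) D by (auto simp: svd_rot_def det_mul)
  ultimately show ?thesis
    by (simp add: rotation_matrix_def)
qed

lemma rotation_matrix_SVD:
  assumes "singular_values A s"
  shows "rotation_matrix (SVD A)"
proof -
  let ?P = "\<lambda>(U, s, V). is_svd A U s V"
  obtain U s' V where E: "(SOME x. ?P x) = (U, s', V)"
    by (rule prod_cases3)
  have "?P (SOME x. ?P x)"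
    using assms by (intro someI_ex[of ?P]) (auto simp: singular_values_def)
  then have "is_svd A U s' V"
    unfolding E by simp
  moreover have "SVD A = svd_rot U V"
    unfolding SVD_def E by simp
  ultimately show ?thesis
    by (simp add: is_svd_def rotation_matrix_svd_rot)
qed

section \<open>The projection to SE(3)\<close>

definition pool :: "('u::finite \<Rightarrow> 'a::real_vector) \<Rightarrow> 'a" where
  "pool g = (1 / real CARD('u)) *\<^sub>R (\<Sum>u\<in>UNIV. g u)"

text \<open>Inverse of stacking columns; the inner vectors below are the rows of the matrix.\<close>

definition unvec :: "real^9 \<Rightarrow> real^3^3" where
  "unvec v = vector [vector [v$1, v$4, v$7],
                     vector [v$2, v$5, v$8],
                     vector [v$3, v$6, v$9]]"

definition r_hat :: "'u::finite tensor_field \<Rightarrow> real^3^3" where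
  "r_hat f = unvec (pool (feat11 f))"

text \<open>\<open>(r, t)\<close> with \<open>r\<close> in SO(3) represents the rigid motion $x \mapsto rx + t$.\<close>

definition SE3 :: "((real^3^3) \<times> (real^3)) set" where
  "SE3 = {(r, t). rotation_matrix r}"

definition Phi_P :: "'u::finite tensor_field \<Rightarrow> (real^3^3) \<times> (real^3)" where
  "Phi_P f =
    (let r = SVD (r_hat f);
         mX = pool (\<lambda>u. x_part (pts f u));
         mY = pool (\<lambda>u. y_part (pts f u));
         tX = pool (feat10 f);
         tY = pool (feat01 f)
     in (r, (mY + tY) - r *v (mX + tX)))"

lemma Phi_P_in_SE3:
  assumes "singular_values (r_hat f) s"
  shows "Phi_P f \<in> SE3"
  using rotation_matrix_SVD[OF assms] by (simp add: Phi_P_def SE3_def Let_def)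

end

theory Submission
  imports Defs
begin

text \<open>
  The rotation \<open>svd_rot U V\<close> maximises $\mathrm{tr}(Q^T A)$ over all rotations $Q$, for every
  singular value decomposition of $A$, and it is the only maximiser as soon as $\sigma_2 > \sigma_3$
  in one of them. Hence it does not depend on the decomposition, and since a decomposition of
  $cA$ becomes one of $A$ by rescaling the singular values, \<open>SVD\<close> is invariant under
  positive scaling. The translation part is then linear in the field.
\<close>

section \<open>Orthogonal matrices of order three\<close>

lemma orthogonal_matrix_row_square_sum:
  fixes W :: "real^3^3"
  assumes "orthogonal_matrix W"
  shows "(W$i$1)\<^sup>2 + (W$i$2)\<^sup>2 + (W$i$3)\<^sup>2 = 1"
proof -
  have "(W ** transpose W)$i$i = 1"
    using assms by (simp add: orthogonal_matrix_def mat_def)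
  then show ?thesis
    by (simp add: matrix_matrix_mult_def transpose_def sum_3 power2_eq_square)
qed

lemma orthogonal_matrix_column_square_sum:
  fixes W :: "real^3^3"
  assumes "orthogonal_matrix W"
  shows "(W$1$j)\<^sup>2 + (W$2$j)\<^sup>2 + (W$3$j)\<^sup>2 = 1"
proof -
  have "orthogonal_matrix (transpose W)"
    using assms by (simp add: orthogonal_matrix_transpose)
  from orthogonal_matrix_row_square_sum[OF this, of j] show ?thesis
    by (simp add: transpose_def)
qed

lemma orthogonal_matrix_entry_le_1:
  fixes W :: "real^3^3"
  assumes "orthogonal_matrix W"
  shows "\<bar>W$i$j\<bar> \<le> 1"
proof -
  have "(W$i$j)\<^sup>2 \<le> 1"
    using orthogonal_matrix_row_square_sum[OF assms, of i] exhaust_3[of j]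
      zero_le_power2[of "W$i$1"] zero_le_power2[of "W$i$2"] zero_le_power2[of "W$i$3"]
    by (smt (verit))
  then show ?thesis
    by (simp add: abs_square_le_1)
qed

text \<open>An orthogonal matrix equals its cofactor matrix up to the factor \<open>det W\<close>.
  The diagonal cofactors come from its action on cross products of coordinate axes.\<close>

lemma orthogonal_matrix_diag_minors:
  fixes W :: "real^3^3"
  assumes "orthogonal_matrix W"
  shows "W$2$2 * W$3$3 - W$2$3 * W$3$2 = det W * W$1$1"
    and "W$1$1 * W$3$3 - W$1$3 * W$3$1 = det W * W$2$2"
    and "W$1$1 * W$2$2 - W$1$2 * W$2$1 = det W * W$3$3"
proof -
  have *: "cross3 (W *v axis i 1) (W *v axis j 1) = det W *\<^sub>R (W *v cross3 (axis i 1) (axis j 1))" for i j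
    using cross_orthogonal_matrix[OF assms] by simp
  show "W$2$2 * W$3$3 - W$2$3 * W$3$2 = det W * W$1$1"
    using arg_cong[OF *[of 2 3], of "\<lambda>v. v$1"]
    by (simp add: cross3_simps matrix_vector_mult_def sum_3 axis_def)
  show "W$1$1 * W$3$3 - W$1$3 * W$3$1 = det W * W$2$2"
    using arg_cong[OF *[of 3 1], of "\<lambda>v. v$2"]
    by (simp add: cross3_simps matrix_vector_mult_def sum_3 axis_def)
  show "W$1$1 * W$2$2 - W$1$2 * W$2$1 = det W * W$3$3"
    using arg_cong[OF *[of 1 2], of "\<lambda>v. v$3"]
    by (simp add: cross3_simps matrix_vector_mult_def sum_3 axis_def)
qed

text \<open>For determinant 1 the entry bounds suffice. For determinant -1 the bound 1 on the trace
  is sharper than they give, and comes from a sum of squares.\<close>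

lemma orthogonal_matrix_trace_le:
  fixes W :: "real^3^3"
  assumes W: "orthogonal_matrix W"
  shows "W$1$1 + W$2$2 + W$3$3 \<le> 2 + det W"
proof -
  let ?t = "W$1$1 + W$2$2 + W$3$3"
  have le: "\<bar>W$i$i\<bar> \<le> 1" for i
    using orthogonal_matrix_entry_le_1[OF W] .
  consider "det W = 1" | "det W = - 1"
    using det_orthogonal_matrix[OF W] by blast
  then show ?thesis
  proof cases
    case 1
    then show ?thesis
      using le[of 1] le[of 2] le[of 3] by linarith
  next
    case 2
    \<comment> \<open>The rows turn the off-diagonal squares into 3 minus the diagonal squares; the
      minors, with determinant -1, replace each product \<open>W$i$j * W$j$i\<close> by diagonal
      entries.\<close>
    have "(W$1$2 - W$2$1)\<^sup>2 + (W$1$3 - W$3$1)\<^sup>2 + (W$2$3 - W$3$2)\<^sup>2 = (3 + ?t) * (1 - ?t)"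
      using orthogonal_matrix_row_square_sum[OF W, of 1]
        orthogonal_matrix_row_square_sum[OF W, of 2] orthogonal_matrix_row_square_sum[OF W, of 3]
        orthogonal_matrix_diag_minors[OF W] 2
      by (simp add: power2_eq_square algebra_simps)
    then have "0 \<le> (3 + ?t) * (1 - ?t)"
      by (metis add_nonneg_nonneg zero_le_power2)
    then have "?t \<le> 1"
      by (auto simp: zero_le_mult_iff)
    then show ?thesis
      using 2 by simp
  qed
qed

text \<open>A unit row or column with an entry 1 vanishes elsewhere, so only \<open>W$3$3\<close>
  remains to be found, and it is the determinant.\<close>

lemma orthogonal_matrix_eq_diag3:
  fixes W :: "real^3^3"
  assumes W: "orthogonal_matrix W" and 1: "W$1$1 = 1" and 2: "W$2$2 = 1"
  shows "W = diag3 (vector [1, 1, det W])"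
proof -
  have z: "W$1$2 = 0" "W$1$3 = 0" "W$2$1 = 0" "W$2$3 = 0" "W$3$1 = 0" "W$3$2 = 0"
    using orthogonal_matrix_row_square_sum[OF W, of 1] orthogonal_matrix_row_square_sum[OF W, of 2]
      orthogonal_matrix_column_square_sum[OF W, of 1] orthogonal_matrix_column_square_sum[OF W, of 2]
    by (simp_all add: 1 2 add_nonneg_eq_0_iff)
  then have "det W = W$3$3"
    by (simp add: det_3 1 2)
  with z show ?thesis
    by (simp add: vec_eq_iff forall_3 diag3_def 1 2)
qed

section \<open>Extremal characterisation of the SVD projection\<close>

lemma orthogonal_matrix_weighted_trace:
  fixes W :: "real^3^3" and s :: "real^3"
  assumes W: "orthogonal_matrix W" and s: "s$1 \<ge> s$2" "s$2 \<ge> s$3" "s$3 \<ge> 0"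
  shows "s$1 * W$1$1 + s$2 * W$2$2 + s$3 * W$3$3 \<le> s$1 + s$2 + det W * s$3"
    and "\<lbrakk>s$2 > s$3; s$1 * W$1$1 + s$2 * W$2$2 + s$3 * W$3$3 = s$1 + s$2 + det W * s$3\<rbrakk>
      \<Longrightarrow> W = diag3 (vector [1, 1, det W])"
proof -
  \<comment> \<open>Abel summation: the deficit is split along the weights \<open>s$3\<close>,
    \<open>s$2 - s$3\<close> and \<open>s$1 - s$2\<close>. The trace bound makes the first term
    nonnegative, the entry bounds the other two.\<close>
  let ?a = "s$3 * (2 + det W - (W$1$1 + W$2$2 + W$3$3))"
  let ?b = "(s$2 - s$3) * (2 - W$1$1 - W$2$2)"
  let ?c = "(s$1 - s$2) * (1 - W$1$1)"
  have le: "W$1$1 \<le> 1" "W$2$2 \<le> 1"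
    using orthogonal_matrix_entry_le_1[OF W] abs_le_D1 by blast+
  have abel: "s$1 + s$2 + det W * s$3 - (s$1 * W$1$1 + s$2 * W$2$2 + s$3 * W$3$3) = ?a + ?b + ?c"
    by (simp add: algebra_simps)
  have nonneg: "?a \<ge> 0" "?b \<ge> 0" "?c \<ge> 0"
    using s le orthogonal_matrix_trace_le[OF W] by simp_all
  show "s$1 * W$1$1 + s$2 * W$2$2 + s$3 * W$3$3 \<le> s$1 + s$2 + det W * s$3"
    using abel nonneg by linarith
  assume "s$2 > s$3" "s$1 * W$1$1 + s$2 * W$2$2 + s$3 * W$3$3 = s$1 + s$2 + det W * s$3"
  \<comment> \<open>Equality makes all three terms vanish, and the weight of \<open>?b\<close> is
    positive.\<close>
  then have "2 - W$1$1 - W$2$2 = 0"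
    using abel nonneg by (smt (verit) mult_eq_0_iff)
  with le show "W = diag3 (vector [1, 1, det W])"
    by (intro orthogonal_matrix_eq_diag3[OF W]) linarith+
qed

text \<open>Cyclicity of the trace passes to the bases of singular vectors, where \<open>A\<close>
  becomes diagonal.\<close>

lemma trace_transpose_mult_svd:
  assumes "is_svd A U s V"
  defines "W \<equiv> \<lambda>Q. transpose U ** Q ** V"
  shows "trace (transpose Q ** A) = s$1 * W Q$1$1 + s$2 * W Q$2$2 + s$3 * W Q$3$3"
proof -
  have "trace (transpose Q ** A) = trace ((transpose Q ** U ** diag3 s) ** transpose V)"
    using assms(1) by (simp add: is_svd_def matrix_mul_assoc)
  also have "\<dots> = trace (transpose V ** (transpose Q ** U ** diag3 s))"
    by (rule trace_mul_sym)
  also have "\<dots> = trace (transpose (W Q) ** diag3 s)"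
    by (simp add: W_def matrix_transpose_mul matrix_mul_assoc)
  also have "\<dots> = s$1 * W Q$1$1 + s$2 * W Q$2$2 + s$3 * W Q$3$3"
    by (simp add: trace_def matrix_matrix_mult_def diag3_def transpose_def sum_3)
  finally show ?thesis .
qed

lemma svd_rot_extremal:
  assumes svd: "is_svd A U s V" and Q: "rotation_matrix Q"
  shows "trace (transpose Q ** A) \<le> trace (transpose (svd_rot U V) ** A)"
    and "\<lbrakk>s$2 > s$3; trace (transpose Q ** A) = trace (transpose (svd_rot U V) ** A)\<rbrakk>
      \<Longrightarrow> Q = svd_rot U V"
proof -
  let ?d = "det U * det V"
  define W where "W = transpose U ** Q ** V"
  have U: "orthogonal_matrix U" and V: "orthogonal_matrix V"
    and s: "s$1 \<ge> s$2" "s$2 \<ge> s$3" "s$3 \<ge> 0"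
    using svd by (auto simp: is_svd_def)
  have UV: "transpose U ** U = mat 1" "U ** transpose U = mat 1"
    "transpose V ** V = mat 1" "V ** transpose V = mat 1"
    using U V by (auto simp: orthogonal_matrix_def)
  have W: "orthogonal_matrix W"
    using U V Q by (simp add: W_def rotation_matrix_def orthogonal_matrix_mul orthogonal_matrix_transpose)
  \<comment> \<open>Since \<open>det Q = 1\<close>, this value is the same for all rotations
    \<open>Q\<close>, so they share one upper bound.\<close>
  have det: "det W = ?d"
    using Q by (simp add: W_def rotation_matrix_def det_mul)
  have rot: "svd_rot U V = U ** diag3 (vector [1, 1, ?d]) ** transpose V"
    using det_orthogonal_matrix[OF U] det_orthogonal_matrix[OF V]
    by (auto simp: svd_rot_def det_mul)
  have "transpose U ** svd_rot U V ** V
      = (transpose U ** U) ** diag3 (vector [1, 1, ?d]) ** (transpose V ** V)"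
    by (simp only: rot matrix_mul_assoc)
  then have "transpose U ** svd_rot U V ** V = diag3 (vector [1, 1, ?d])"
    by (simp add: UV)
  then have max: "trace (transpose (svd_rot U V) ** A) = s$1 + s$2 + det W * s$3"
    by (simp add: trace_transpose_mult_svd[OF svd] det diag3_def)
  have tr: "trace (transpose Q ** A) = s$1 * W$1$1 + s$2 * W$2$2 + s$3 * W$3$3"
    by (simp add: trace_transpose_mult_svd[OF svd] W_def)
  show "trace (transpose Q ** A) \<le> trace (transpose (svd_rot U V) ** A)"
    unfolding max tr by (rule orthogonal_matrix_weighted_trace(1)[OF W s])
  assume "s$2 > s$3" "trace (transpose Q ** A) = trace (transpose (svd_rot U V) ** A)"
  then have "W = diag3 (vector [1, 1, ?d])"
    using orthogonal_matrix_weighted_trace(2)[OF W s] unfolding max tr det by blast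
  then have "svd_rot U V = U ** W ** transpose V"
    by (simp add: rot)
  also have "\<dots> = (U ** transpose U) ** Q ** (V ** transpose V)"
    by (simp only: W_def matrix_mul_assoc)
  finally show "Q = svd_rot U V"
    by (simp add: UV)
qed

lemma svd_rot_unique:
  assumes svd: "is_svd A U s V" and gap: "s$2 > s$3" and svd': "is_svd A U' s' V'"
  shows "svd_rot U' V' = svd_rot U V"
proof -
  have rot: "rotation_matrix (svd_rot U V)" "rotation_matrix (svd_rot U' V')"
    using svd svd' by (auto simp: is_svd_def rotation_matrix_svd_rot)
  show ?thesis
    \<comment> \<open>Each rotation is maximal for the trace, so the two traces agree; the equality
      case for the decomposition with the gap then identifies the rotations.\<close>
    using svd_rot_extremal(1)[OF svd' rot(1)] svd_rot_extremal(1)[OF svd rot(2)]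
    by (intro svd_rot_extremal(2)[OF svd rot(2) gap]) simp
qed

lemma SVD_eq_svd_rot:
  assumes "is_svd A U s V" and "s$2 > s$3"
  shows "SVD A = svd_rot U V"
proof -
  let ?P = "\<lambda>(U, s, V). is_svd A U s V"
  obtain U' s' V' where E: "(SOME x. ?P x) = (U', s', V')"
    by (rule prod_cases3)
  have "?P (SOME x. ?P x)"
    using assms(1) by (intro someI_ex[of ?P]) auto
  then have "is_svd A U' s' V'"
    unfolding E by simp
  moreover have "SVD A = svd_rot U' V'"
    unfolding SVD_def E by simp
  ultimately show ?thesis
    using svd_rot_unique[OF assms] by simp
qed

lemma is_svd_scaleR:
  assumes "is_svd A U s V" and "c \<ge> 0"
  shows "is_svd (c *\<^sub>R A) U (c *\<^sub>R s) V"
proof -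
  have "diag3 (c *\<^sub>R s) = c *\<^sub>R diag3 s"
    by (simp add: diag3_def vec_eq_iff)
  then show ?thesis
    using assms by (simp add: is_svd_def mult_left_mono scalar_matrix_assoc matrix_scalar_ac)
qed

lemma SVD_scaleR:
  assumes "singular_values A s" and "s$2 > s$3" and "c > 0"
  shows "SVD (c *\<^sub>R A) = SVD A"
proof -
  obtain U V where svd: "is_svd A U s V"
    using assms(1) by (auto simp: singular_values_def)
  have "SVD (c *\<^sub>R A) = svd_rot U V"
    using assms(2,3) by (intro SVD_eq_svd_rot[OF is_svd_scaleR[OF svd]]) simp_all
  then show ?thesis
    using SVD_eq_svd_rot[OF svd assms(2)] by simp
qed

section \<open>Equivariance of the projection\<close>

lemma pool_scaleR: "pool (\<lambda>u. c *\<^sub>R g u) = c *\<^sub>R pool g"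
  by (simp add: pool_def flip: scaleR_sum_right)

lemma x_part_scaleR: "x_part (c *\<^sub>R z) = c *\<^sub>R x_part z"
  by (simp add: x_part_def vec_eq_iff forall_3)

lemma y_part_scaleR: "y_part (c *\<^sub>R z) = c *\<^sub>R y_part z"
  by (simp add: y_part_def vec_eq_iff forall_3)

lemma unvec_scaleR: "unvec (c *\<^sub>R v) = c *\<^sub>R unvec v"
  by (simp add: unvec_def vec_eq_iff forall_3)

lemma r_hat_scale_act: "r_hat (scale_act p c f) = c ^ p *\<^sub>R r_hat f"
  by (simp add: r_hat_def scale_act_def pool_scaleR unvec_scaleR)

theorem proposition5p3:
  fixes f :: "'u::finite tensor_field"
    and \<sigma> :: "real^3" and r :: "real^3^3" and t :: "real^3"
  assumes "singular_values (r_hat f) \<sigma>"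
    and "\<sigma>$2 > \<sigma>$3"
    and "Phi_P f = (r, t)"
  shows "\<forall>c>0. Phi_P (scale_act 1 c f) = (r, c *\<^sub>R t)"
proof (intro allI impI)
  fix c :: real
  assume "c > 0"
  then have "SVD (r_hat (scale_act 1 c f)) = SVD (r_hat f)"
    using SVD_scaleR[OF assms(1,2)] by (simp add: r_hat_scale_act)
  then show "Phi_P (scale_act 1 c f) = (r, c *\<^sub>R t)"
    using assms(3)
    \<comment> \<open>In degree 1 the pooled features scale by the same factor \<open>c\<close> as
      the means of the points, so their sums scale by \<open>c\<close> too.\<close>
    by (auto simp: Phi_P_def Let_def scale_act_def pool_scaleR x_part_scaleR y_part_scaleR
        matrix_vector_mult_scaleR scaleR_add_right scaleR_diff_right matrix_vector_right_distrib)
qed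

end
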